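(* Let $0<c<1$ be a constant, and let $s=s(n)=c\cdot n$, rounded to an integer (i.e. $s(n)$ is an integer with $|s(n)-cn|<1$), where $n$ is large enough that $1\le s(n)\le n-1$. Let $Y=Y_{n,s(n)}$ be the number of draws needed to collect all $n$ coupons when each draw is an independent, uniformly random $s(n)$-subset of the $n$ coupons. Let $\alpha(n)=\{\log_{1/(1-c)} n\}$, and define $g:[0,1)\to\mathbb{R}$ by $$g(x)=\sum_{i=1}^{\infty}\left(1-e^{-(1-c)^{i-x-1}}-e^{-(1-c)^{-i-x}}\right),\qquad x\in[0,1).$$ Then, as $n\to\infty$, $$\mathbb{E}[Y]=\left\lfloor \log_{1/(1-c)} n\right\rfloor + g(\alpha(n)) + o(1).$$
   Context: Coupon collector's problem with group drawings: there are $n$ distinct coupons. At each step (draw) $k=1,2,3,\ldots$ one obtains a package, which is a set of $s$ distinct coupons ($1\le s\le n-1$), chosen uniformly at random among all $\binom{n}{s}$ subsets of size $s$, independently of the other draws. $Y_{n,s}$ is the (random) smallest number of draws after which every one of the $n$ coupons has appeared in at least one drawn package. $\{y\}=y-\lfloor y\rfloor$ denotes the fractional part of a real number $y$. The exponents in $g$ are to be read as $-\big((1-c)^{i-x-1}\big)$ and $-\big((1-c)^{-i-x}\big)$. *)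

theory Defs
  imports "HOL-Probability.Probability" "HOL-Library.Landau_Symbols"
begin

text \<open>The coupons are the numbers below \<open>n\<close>; a package consists of \<open>s\<close> distinct coupons.\<close>

definition packages :: "nat \<Rightarrow> nat \<Rightarrow> nat set set" where
  "packages n s = {A. A \<subseteq> {..<n} \<and> card A = s}"

text \<open>
  \<open>X k\<close> is the package obtained in draw \<open>k = 1, 2, 3, \<dots>\<close>; the value \<open>X 0\<close> plays no role.
  The probability space carrying the draws is arbitrary.
\<close>

definition group_drawings ::
    "nat \<Rightarrow> nat \<Rightarrow> 'w measure \<Rightarrow> (nat \<Rightarrow> 'w \<Rightarrow> nat set) \<Rightarrow> bool" where
  "group_drawings n s M X \<longleftrightarrow>
     1 \<le> s \<and> s < n \<and> prob_space M \<and>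
     prob_space.indep_vars M (\<lambda>_. count_space (packages n s)) X {1..} \<and>
     (\<forall>k\<ge>1. distr M (count_space (packages n s)) (X k) = uniform_count_measure (packages n s))"

text \<open>
  As an infimum in \<^typ>\<open>enat\<close>, the collection time is \<open>\<infinity>\<close> on the (null) event that some coupon
  never appears.
\<close>

definition collection_time :: "nat \<Rightarrow> (nat \<Rightarrow> 'w \<Rightarrow> nat set) \<Rightarrow> 'w \<Rightarrow> enat" where
  "collection_time n X \<omega> = (INF k \<in> {k. {..<n} \<subseteq> (\<Union>j\<in>{1..k}. X j \<omega>)}. enat k)"

definition expected_collection_time ::
    "nat \<Rightarrow> 'w measure \<Rightarrow> (nat \<Rightarrow> 'w \<Rightarrow> nat set) \<Rightarrow> ennreal" where
  "expected_collection_time n M X = (\<integral>\<^sup>+ \<omega>. ennreal_of_enat (collection_time n X \<omega>) \<partial>M)"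

text \<open>The series starts at \<open>i = 1\<close>, hence \<^const>\<open>Suc\<close>. Only arguments \<open>0 \<le> x < 1\<close> matter.\<close>

definition g :: "real \<Rightarrow> real \<Rightarrow> real" where
  "g c x = (\<Sum>i. 1 - exp (- ((1 - c) powr (real (Suc i) - x - 1)))
                   - exp (- ((1 - c) powr (- real (Suc i) - x))))"

end

theory Submission
  imports Defs
begin

text \<open>
  Let \<open>W\<close> be the number of coupons missing after \<open>k\<close> draws, and \<open>\<mu> = n (1 - s/n)^k\<close> its mean. Its
  binomial moments are explicit and close to those of a Poisson variable, so inclusion-exclusion
  gives \<open>P(W = 0) = exp (- \<mu>) + o(1)\<close> as long as \<open>\<mu>\<close> stays bounded; moreover \<open>P(W > 0) \<le> \<mu>\<close>, and
  \<open>P(W = 0) \<le> 1/\<mu>\<close> by Chebyshev's inequality. Write \<open>f = \<lfloor>L\<rfloor>\<close> with \<open>L = log n\<close> to base \<open>1/(1-c)\<close>.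
  At \<open>k = f + i\<close>, for a fixed integer \<open>i\<close>, the mean is \<open>(1-c)^(i - frac L) + o(1)\<close>, so in
  \<open>E[Y] = f + (\<Sum>i\<ge>0. P(Y > f + i)) - (\<Sum>1\<le>i\<le>f. P(Y \<le> f - i))\<close> every term converges to the
  corresponding term of \<open>g\<close>. The two tail bounds decay geometrically in \<open>i\<close>, uniformly in \<open>n\<close>, and
  Tannery's theorem concludes.
\<close>

section \<open>Binomial moments of the number of missing coupons\<close>

text \<open>
  The expectation of \<open>W choose j\<close>, where \<open>W\<close> is the number of coupons missing after \<open>k\<close> draws:
  the second factor is the probability that \<open>k\<close> packages all avoid a given set of \<open>j\<close> coupons.
\<close>

definition choose_moment :: "nat \<Rightarrow> nat \<Rightarrow> nat \<Rightarrow> nat \<Rightarrow> real" where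
  "choose_moment n s k j = real (n choose j) * (real ((n - j) choose s) / real (n choose s)) ^ k"

text \<open>The case \<open>j = 1\<close> of \<open>choose_moment\<close>, by
  \<open>((n - 1) choose s) / (n choose s) = (n - s) / n\<close>.\<close>

definition mean_missing :: "nat \<Rightarrow> nat \<Rightarrow> nat \<Rightarrow> real" where
  "mean_missing n s k = real n * (real (n - s) / real n) ^ k"

lemma choose_moment_0: "s < n \<Longrightarrow> choose_moment n s k 0 = 1"
  by (simp add: choose_moment_def)

lemma choose_moment_nonneg: "0 \<le> choose_moment n s k j"
  by (simp add: choose_moment_def)

lemma choose_moment_eq_0: "n < j \<Longrightarrow> choose_moment n s k j = 0"
  by (simp add: choose_moment_def)

lemma mean_missing_pos: "s < n \<Longrightarrow> 0 < mean_missing n s k"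
  by (simp add: mean_missing_def)

text \<open>Two absorption identities give the quotient of consecutive moments. With this recursion,
  the Poisson bounds from above and below are inductions on \<open>j\<close>.\<close>

lemma choose_moment_Suc:
  assumes "s < n"
  shows "choose_moment n s k (Suc j) =
    choose_moment n s k j * (real (n - j) * (real (n - s - j) / real (n - j)) ^ k) / real (Suc j)"
proof (cases "j < n")
  case True
  have "real (Suc j) * real (n choose Suc j) = real (n - j) * real (n choose j)"
    using True by (metis binomial_absorb_comp binomial_absorption of_nat_mult Suc_diff_1 gr_implies_not0 gr0I Suc_times_binomial_eq)
  hence 1: "real (n choose Suc j) = real (n choose j) * real (n - j) / real (Suc j)"
    by (simp add: field_simps del: of_nat_Suc)
  have "real (n - j - s) * real ((n - j) choose s) = real (n - j) * real ((n - j - 1) choose s)"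
    by (metis binomial_absorb_comp of_nat_mult)
  hence 2: "real ((n - Suc j) choose s) = real ((n - j) choose s) * (real (n - s - j) / real (n - j))"
    using True by (simp add: field_simps diff_commute)
  show ?thesis
    unfolding choose_moment_def 1 2 by (simp add: power_mult_distrib power_divide mult_ac del: of_nat_Suc)
\<comment> \<open>For \<open>n \<le> j\<close> the left side contains
  \<open>n choose Suc j = 0\<close> and the right side the truncated factor
  \<open>n - j = 0\<close>.\<close>
qed (simp add: choose_moment_def)

lemma choose_moment_1: "s < n \<Longrightarrow> choose_moment n s k 1 = mean_missing n s k"
  using choose_moment_Suc[of s n k 0] by (simp add: choose_moment_0 mean_missing_def)

section \<open>Comparison with the binomial moments of a Poisson variable\<close>

lemma survival_ratio_mono:
  assumes "s < n"
  shows "real (n - j) * (real (n - s - j) / real (n - j)) ^ k \<le> mean_missing n s k"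
proof (cases "j < n - s")
  case True
  \<comment> \<open>Subtracting the same \<open>j\<close> from numerator and denominator cannot
    increase a fraction that is at most 1.\<close>
  have "real (n - s - j) / real (n - j) \<le> real (n - s) / real n"
    using True assms by (simp add: field_simps)
  thus ?thesis
    unfolding mean_missing_def by (intro mult_mono power_mono) auto
next
  case False
  \<comment> \<open>Truncated subtraction makes the numerator 0, so the power vanishes unless
    \<open>k = 0\<close>.\<close>
  show ?thesis
  proof (cases "k = 0")
    case False
    moreover have "n - s - j = 0" using \<open>\<not> j < n - s\<close> by simp
    ultimately show ?thesis using mean_missing_pos[OF assms, of k] by (simp add: power_0_left del: of_nat_diff)
  qed (simp add: mean_missing_def)
qed

lemma choose_moment_le:
  assumes "s < n"
  shows "choose_moment n s k j \<le> mean_missing n s k ^ j / fact j"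
proof (induction j)
  case (Suc j)
  have "choose_moment n s k (Suc j) \<le> (mean_missing n s k ^ j / fact j) * mean_missing n s k / real (Suc j)"
    unfolding choose_moment_Suc[OF assms]
    by (intro divide_right_mono mult_mono Suc survival_ratio_mono assms) (auto simp: mean_missing_def)
  thus ?case by (simp add: field_simps)
qed (simp add: choose_moment_0[OF assms])

text \<open>Compared with the mean, each of the \<open>k + 1\<close> factors keeps at least the
  proportion \<open>1 - t\<close> with \<open>t = j / (n - s)\<close>; Bernoulli's inequality bounds
  \<open>(1 - t) ^ (k + 1)\<close> from below.\<close>

lemma survival_ratio_lower:
  assumes "s < n" "j < n - s"
  shows "mean_missing n s k * (1 - real (k + 1) * real j / real (n - s))
    \<le> real (n - j) * (real (n - s - j) / real (n - j)) ^ k"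
proof -
  define t where "t = real j / real (n - s)"
  have t: "0 \<le> t" "t < 1" using assms by (auto simp: t_def)
  have 1: "real (n - s) / real n * (1 - t) \<le> real (n - s - j) / real (n - j)"
  proof -
    have "real (n - s) * (1 - t) = real (n - s - j)"
      using assms by (simp add: t_def field_simps)
    thus ?thesis using assms by (auto simp: intro!: divide_left_mono)
  qed
  have 2: "real n * (1 - t) \<le> real (n - j)"
  proof -
    have "real j \<le> real n * t"
      using assms by (simp add: t_def field_simps mult_left_mono)
    thus ?thesis using assms by (simp add: algebra_simps)
  qed
  have "1 - real (k + 1) * t \<le> (1 - t) ^ (k + 1)"
    using Bernoulli_inequality[of "- t" "k + 1"] t by (simp add: algebra_simps)
  hence "mean_missing n s k * (1 - real (k + 1) * t) \<le> mean_missing n s k * (1 - t) ^ (k + 1)"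
    using mean_missing_pos[OF assms(1), of k] by (intro mult_left_mono) auto
  also have "\<dots> = (real n * (1 - t)) * (real (n - s) / real n * (1 - t)) ^ k"
    by (simp add: mean_missing_def power_mult_distrib power_divide)
  also have "\<dots> \<le> real (n - j) * (real (n - s - j) / real (n - j)) ^ k"
    using t by (intro mult_mono power_mono 1 2) auto
  finally show ?thesis by (simp add: t_def)
qed

text \<open>The recursion step at index \<open>i\<close> costs a relative loss of at most
  \<open>(k + 1) i / (n - s)\<close>; over \<open>i < j\<close> the losses add up to at most the
  quadratic term.\<close>

lemma choose_moment_ge:
  assumes "s < n"
  shows "mean_missing n s k ^ j / fact j * (1 - real (k + 1) * (real j)\<^sup>2 / real (n - s)) \<le> choose_moment n s k j"
proof (induction j)
  case (Suc j)
  define m where "m = mean_missing n s k"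
  define d where "d = real (k + 1) / real (n - s)"
  have m: "0 < m" and d: "0 \<le> d" using mean_missing_pos[OF assms] by (auto simp: m_def d_def)
  have IH: "m ^ j / fact j * (1 - d * (real j)\<^sup>2) \<le> choose_moment n s k j"
    using Suc by (simp add: m_def d_def)
  have "m ^ Suc j / fact (Suc j) * (1 - d * (real (Suc j))\<^sup>2) \<le> choose_moment n s k (Suc j)"
  proof (cases "j < n - s")
    case True
    have up: "choose_moment n s k j \<le> m ^ j / fact j"
      using choose_moment_le[OF assms] by (simp add: m_def)
    \<comment> \<open>Since \<open>j^2 + j \<le> (j + 1)^2\<close>, the quadratic error absorbs the
      loss of one more step.\<close>
    have "d * (real j)\<^sup>2 + d * real j \<le> d * (real (Suc j))\<^sup>2"
      using d by (simp add: power2_eq_square algebra_simps)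
    hence "m ^ j / fact j * (1 - d * (real (Suc j))\<^sup>2) \<le> m ^ j / fact j * (1 - d * (real j)\<^sup>2 - d * real j)"
      using m by (intro mult_left_mono) auto
    \<comment> \<open>The factor \<open>1 - d * j\<close> may be negative. Hence the induction
      hypothesis serves for the main part and the upper bound \<open>up\<close> for the subtracted
      part.\<close>
    also have "\<dots> = m ^ j / fact j * (1 - d * (real j)\<^sup>2) - m ^ j / fact j * (d * real j)"
      by (simp add: algebra_simps)
    also have "\<dots> \<le> choose_moment n s k j - choose_moment n s k j * (d * real j)"
      using d by (intro diff_mono IH mult_right_mono up) auto
    finally have 1: "m ^ j / fact j * (1 - d * (real (Suc j))\<^sup>2) \<le> choose_moment n s k j * (1 - d * real j)"
      by (simp add: algebra_simps)
    have "m ^ Suc j / fact (Suc j) * (1 - d * (real (Suc j))\<^sup>2)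
      = m ^ j / fact j * (1 - d * (real (Suc j))\<^sup>2) * (m / real (Suc j))"
      by (simp add: field_simps)
    also have "\<dots> \<le> choose_moment n s k j * (1 - d * real j) * (m / real (Suc j))"
      using m by (intro mult_right_mono 1) auto
    also have "\<dots> = choose_moment n s k j * (m * (1 - d * real j)) / real (Suc j)"
      by simp
    also have "\<dots> \<le> choose_moment n s k (Suc j)"
      unfolding choose_moment_Suc[OF assms]
      using survival_ratio_lower[OF assms True, of k]
      by (intro divide_right_mono mult_left_mono choose_moment_nonneg) (auto simp: m_def d_def)
    finally show ?thesis .
  next
    case False
    \<comment> \<open>Once \<open>n - s \<le> j\<close>, the correction factor is nonpositive and
      the bound is trivial.\<close>
    have "real (n - s) \<le> real (k + 1) * (real (Suc j))\<^sup>2"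
    proof -
      have "n - s \<le> Suc j * Suc j" using False by simp
      also have "\<dots> \<le> (k + 1) * (Suc j * Suc j)" by simp
      finally have "real (n - s) \<le> real ((k + 1) * (Suc j * Suc j))" by (rule of_nat_mono)
      thus ?thesis by (simp only: of_nat_mult power2_eq_square)
    qed
    hence "1 - d * (real (Suc j))\<^sup>2 \<le> 0"
      using assms by (simp add: d_def divide_simps del: of_nat_Suc)
    hence "m ^ Suc j / fact (Suc j) * (1 - d * (real (Suc j))\<^sup>2) \<le> 0"
      using m by (intro mult_nonneg_nonpos) auto
    thus ?thesis using choose_moment_nonneg order_trans by blast
  qed
  thus ?case by (simp add: m_def d_def)
qed (simp add: choose_moment_0[OF assms])

text \<open>Termwise comparison with the exponential series at \<open>- m\<close>: the two moment
  bounds make the gap at index \<open>j\<close> at most \<open>d * j^2 * m^j / j!\<close>, and these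
  gaps are dominated by another exponential series.\<close>

lemma alternating_choose_moment_approx_exp:
  assumes "s < n"
  shows "\<bar>(\<Sum>j\<le>n. (-1) ^ j * choose_moment n s k j) - exp (- mean_missing n s k)\<bar>
    \<le> real (k + 1) / real (n - s) * exp (4 * mean_missing n s k)"
proof -
  define m where "m = mean_missing n s k"
  define d where "d = real (k + 1) / real (n - s)"
  have m: "0 < m" and d: "0 \<le> d" using mean_missing_pos[OF assms] by (auto simp: m_def d_def)
  have s1: "(\<lambda>j. (-1) ^ j * choose_moment n s k j) sums (\<Sum>j\<le>n. (-1) ^ j * choose_moment n s k j)"
    by (rule sums_finite) (auto simp: choose_moment_eq_0)
  have exp_sums: "(\<lambda>j. x ^ j / fact j) sums exp x" for x :: real
    using exp_converges[of x] by (simp add: divide_inverse mult.commute)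
  have s3: "(\<lambda>j. d * ((4 * m) ^ j / fact j)) sums (d * exp (4 * m))"
    by (intro sums_mult exp_sums)
  have bd: "norm ((-1) ^ j * choose_moment n s k j - (- m) ^ j / fact j) \<le> d * ((4 * m) ^ j / fact j)" for j
  proof -
    have "(-1) ^ j * choose_moment n s k j - (- m) ^ j / fact j = (-1) ^ j * (choose_moment n s k j - m ^ j / fact j)"
      by (simp add: algebra_simps power_minus[of m])
    hence "norm ((-1) ^ j * choose_moment n s k j - (- m) ^ j / fact j) = \<bar>choose_moment n s k j - m ^ j / fact j\<bar>"
      by (simp add: abs_mult power_abs)
    also have "\<dots> = m ^ j / fact j - choose_moment n s k j"
      using choose_moment_le[OF assms, of k j] by (simp add: m_def)
    also have "\<dots> \<le> m ^ j / fact j * (d * (real j)\<^sup>2)"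
      using choose_moment_ge[OF assms, of k j] by (simp add: m_def d_def algebra_simps)
    also have "\<dots> \<le> m ^ j / fact j * (d * 4 ^ j)"
    proof -
      \<comment> \<open>The 4 in the exponent of the error comes from
        \<open>j^2 \<le> (2^j)^2 = 4^j\<close>.\<close>
      have "real j \<le> 2 ^ j" using less_exp[of j] by (metis less_imp_le of_nat_le_numeral_power_cancel_iff)
      hence "(real j)\<^sup>2 \<le> (2 ^ j)\<^sup>2" by (intro power_mono) auto
      also have "\<dots> = 4 ^ j" by (simp flip: power_mult_distrib add: power2_eq_square)
      finally show ?thesis using m d by (intro mult_left_mono) auto
    qed
    also have "\<dots> = d * ((4 * m) ^ j / fact j)" by (simp add: power_mult_distrib)
    finally show ?thesis .
  qed
  have "norm (suminf (\<lambda>j. (-1) ^ j * choose_moment n s k j - (- m) ^ j / fact j)) \<le> suminf (\<lambda>j. d * ((4 * m) ^ j / fact j))"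
    by (rule norm_suminf_le[OF bd sums_summable[OF s3]])
  thus ?thesis
    using sums_unique[OF sums_diff[OF s1 exp_sums[of "- m"]]] sums_unique[OF s3]
    by (simp add: m_def d_def)
qed

text \<open>The binomial expansion of \<open>(1 - 1)^w\<close>. The range up to \<open>n\<close>
  does not depend on \<open>w\<close>, so the sum can be exchanged with an expectation over a random
  \<open>w\<close>.\<close>

lemma indicator_zero_eq_alternating_choose:
  assumes "w \<le> n"
  shows "(\<Sum>j\<le>n. (-1) ^ j * real (w choose j)) = of_bool (w = 0)"
proof -
  have "(\<Sum>j\<le>n. (-1) ^ j * real (w choose j)) = (\<Sum>j\<le>w. (-1) ^ j * real (w choose j))"
    using assms by (intro sum.mono_neutral_right) auto
  thus ?thesis using choose_alternating_sum[of w, where 'a = real] by (cases "w = 0") auto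
qed

section \<open>Random packages\<close>

locale drawings = prob_space M for n s :: nat and M :: "'w measure" and X :: "nat \<Rightarrow> 'w \<Rightarrow> nat set" +
  assumes group_drawings: "group_drawings n s M X"
begin

lemma s_less: "s < n"
  using group_drawings by (simp add: group_drawings_def)

lemma s_pos: "1 \<le> s"
  using group_drawings by (simp add: group_drawings_def)

lemma finite_packages: "finite (packages n j)"
  by (rule finite_subset[of _ "Pow {..<n}"]) (auto simp: packages_def)

lemma card_packages: "card (packages n j) = n choose j"
  unfolding packages_def using n_subsets[of "{..<n}" j] by simp

lemma indep_draws: "indep_vars (\<lambda>_. count_space (packages n s)) X {1..}"
  using group_drawings by (simp add: group_drawings_def)

lemma measurable_draw: "1 \<le> j \<Longrightarrow> X j \<in> measurable M (count_space (packages n s))"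
  using indep_draws by (simp add: indep_vars_def)

section \<open>Sets of coupons avoided by all draws\<close>

definition disjoint_packages :: "nat set \<Rightarrow> nat set set" where
  "disjoint_packages S = {A \<in> packages n s. A \<inter> S = {}}"

definition avoid :: "nat \<Rightarrow> nat set \<Rightarrow> 'w set" where
  "avoid k S = {\<omega> \<in> space M. \<forall>j\<in>{1..k}. X j \<omega> \<inter> S = {}}"

definition missing :: "nat \<Rightarrow> 'w \<Rightarrow> nat set" where
  "missing k \<omega> = {..<n} - (\<Union>j\<in>{1..k}. X j \<omega>)"

lemma finite_missing [simp]: "finite (missing k \<omega>)"
  by (simp add: missing_def)

lemma card_missing_le: "card (missing k \<omega>) \<le> n"
  using card_mono[of "{..<n}" "missing k \<omega>"] by (auto simp: missing_def)

text \<open>Counting under the uniform law: the favourable packages are the \<open>s\<close>-subsets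
  of the complement of \<open>S\<close>.\<close>

lemma prob_draw_avoids:
  assumes "1 \<le> j" "S \<subseteq> {..<n}"
  shows "prob (X j -` disjoint_packages S \<inter> space M)
    = real ((n - card S) choose s) / real (n choose s)"
proof -
  let ?P = "disjoint_packages S"
  have "prob (X j -` ?P \<inter> space M) = measure (distr M (count_space (packages n s)) (X j)) ?P"
    by (rule measure_distr[symmetric]) (auto intro: measurable_draw assms simp: disjoint_packages_def)
  also have "\<dots> = measure (uniform_count_measure (packages n s)) ?P"
    using group_drawings assms(1) by (simp add: group_drawings_def)
  also have "\<dots> = real (card ?P) / real (n choose s)"
    by (subst measure_uniform_count_measure) (auto simp: finite_packages card_packages disjoint_packages_def)
  also have "card ?P = card {A. A \<subseteq> {..<n} - S \<and> card A = s}"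
    by (rule arg_cong[of _ _ card]) (auto simp: packages_def disjoint_packages_def)
  also have "\<dots> = (n - card S) choose s"
    using n_subsets[of "{..<n} - S" s] assms(2) by (simp add: card_Diff_subset finite_subset)
  finally show ?thesis .
qed

text \<open>The form to which independence applies. For \<open>k = 0\<close> the right side would be
  \<open>UNIV\<close>, whereas \<open>avoid 0 S\<close> is \<open>space M\<close>.\<close>

lemma avoid_eq_Inter:
  "1 \<le> k \<Longrightarrow> avoid k S = (\<Inter>j\<in>{1..k}. X j -` disjoint_packages S \<inter> space M)"
  using measurable_space[OF measurable_draw] by (fastforce simp: avoid_def disjoint_packages_def)

lemma avoid_measurable [measurable]: "avoid k S \<in> events"
proof (cases "1 \<le> k")
  case True
  show ?thesis unfolding avoid_eq_Inter[OF True]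
    by (rule sets.finite_INT) (use True in \<open>auto intro!: measurable_sets[OF measurable_draw] simp: disjoint_packages_def simp del: vimage_Collect_eq\<close>)
next
  case False
  thus ?thesis by (simp add: avoid_def)
qed

lemma prob_avoid:
  assumes "S \<subseteq> {..<n}"
  shows "prob (avoid k S) = (real ((n - card S) choose s) / real (n choose s)) ^ k"
proof (cases "1 \<le> k")
  case True
  show ?thesis unfolding avoid_eq_Inter[OF True]
    using True assms by (subst indep_varsD[OF indep_draws]) (auto simp: prob_draw_avoids, auto simp: disjoint_packages_def)
next
  case False
  hence "k = 0" by simp
  thus ?thesis by (simp add: avoid_def prob_space)
qed

text \<open>A \<open>j\<close>-subset of the missing coupons is exactly a \<open>j\<close>-set
  avoided by every draw. The sum of indicators is ready for linearity of expectation.\<close>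

lemma choose_card_missing:
  assumes "\<omega> \<in> space M"
  shows "real (card (missing k \<omega>) choose j) = (\<Sum>S\<in>packages n j. indicator (avoid k S) \<omega>)"
proof -
  have "card (missing k \<omega>) choose j = card {S. S \<subseteq> missing k \<omega> \<and> card S = j}"
    using n_subsets[of "missing k \<omega>" j] by (simp add: missing_def)
  also have "{S. S \<subseteq> missing k \<omega> \<and> card S = j} = {S \<in> packages n j. \<omega> \<in> avoid k S}"
    using assms by (auto simp: missing_def packages_def avoid_def; blast)
  also have "real (card {S \<in> packages n j. \<omega> \<in> avoid k S}) = (\<Sum>S\<in>packages n j. indicator (avoid k S) \<omega>)"
    by (simp add: indicator_def sum.If_cases[OF finite_packages] Int_def of_bool_def)
  finally show ?thesis .
qed

lemma integrable_choose: "integrable M (\<lambda>\<omega>. real (card (missing k \<omega>) choose j))"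
  by (subst Bochner_Integration.integrable_cong[OF refl choose_card_missing])
    (auto simp: emeasure_eq_measure)

lemma expectation_choose: "expectation (\<lambda>\<omega>. real (card (missing k \<omega>) choose j)) = choose_moment n s k j"
proof -
  have "expectation (\<lambda>\<omega>. real (card (missing k \<omega>) choose j))
    = expectation (\<lambda>\<omega>. \<Sum>S\<in>packages n j. indicator (avoid k S) \<omega>)"
    by (rule Bochner_Integration.integral_cong[OF refl choose_card_missing])
  also have "\<dots> = (\<Sum>S\<in>packages n j. prob (avoid k S))"
    by (subst Bochner_Integration.integral_sum) (auto simp: emeasure_eq_measure)
  also have "\<dots> = (\<Sum>S\<in>packages n j. (real ((n - j) choose s) / real (n choose s)) ^ k)"
    by (rule sum.cong) (auto simp: packages_def prob_avoid)
  finally show ?thesis by (simp add: card_packages choose_moment_def)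
qed

section \<open>Probability of a complete collection\<close>

definition complete_prob :: "nat \<Rightarrow> real" where
  "complete_prob k = prob {\<omega> \<in> space M. missing k \<omega> = {}}"

lemma complete_measurable [measurable]: "{\<omega> \<in> space M. missing k \<omega> = {}} \<in> events"
proof -
  have "{\<omega> \<in> space M. missing k \<omega> = {}} = space M - (\<Union>i\<in>{..<n}. avoid k {i})"
    by (auto simp: missing_def avoid_def)
  thus ?thesis by auto
qed

lemma expectation_complete: "complete_prob k = expectation (\<lambda>\<omega>. of_bool (card (missing k \<omega>) = 0))"
proof -
  have "complete_prob k = expectation (indicator {\<omega> \<in> space M. missing k \<omega> = {}})"
    by (simp add: complete_prob_def Int_absorb2)
  also have "\<dots> = expectation (\<lambda>\<omega>. of_bool (card (missing k \<omega>) = 0))"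
    by (rule Bochner_Integration.integral_cong) auto
  finally show ?thesis .
qed

lemma integrable_complete: "integrable M (\<lambda>\<omega>. of_bool (card (missing k \<omega>) = 0) :: real)"
  by (subst Bochner_Integration.integrable_cong
        [OF refl, of _ _ "indicator {\<omega> \<in> space M. missing k \<omega> = {}}"])
    (auto simp: emeasure_eq_measure)

text \<open>Inclusion-exclusion, obtained by taking expectations in the alternating identity for
  \<open>W\<close>, which never exceeds \<open>n\<close>.\<close>

lemma complete_prob_eq_sum: "complete_prob k = (\<Sum>j\<le>n. (-1) ^ j * choose_moment n s k j)"
proof -
  have "complete_prob k = expectation (\<lambda>\<omega>. \<Sum>j\<le>n. (-1) ^ j * real (card (missing k \<omega>) choose j))"
    by (simp add: expectation_complete indicator_zero_eq_alternating_choose[OF card_missing_le])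
  also have "\<dots> = (\<Sum>j\<le>n. (-1) ^ j * choose_moment n s k j)"
    by (subst Bochner_Integration.integral_sum) (simp_all add: integrable_choose expectation_choose)
  finally show ?thesis .
qed

lemma complete_prob_approx:
  "\<bar>complete_prob k - exp (- mean_missing n s k)\<bar>
    \<le> real (k + 1) / real (n - s) * exp (4 * mean_missing n s k)"
  unfolding complete_prob_eq_sum by (rule alternating_choose_moment_approx_exp[OF s_less])

lemma complete_prob_le_1: "complete_prob k \<le> 1"
  by (simp add: complete_prob_def)

text \<open>Markov's inequality: pointwise, \<open>1 - W\<close> is at most the indicator of
  \<open>W = 0\<close>.\<close>

lemma complete_prob_ge: "1 - mean_missing n s k \<le> complete_prob k"
proof -
  have "1 - mean_missing n s k = expectation (\<lambda>\<omega>. 1 - real (card (missing k \<omega>) choose 1))"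
    using expectation_choose[of k 1] integrable_choose[of k 1] choose_moment_1[OF s_less, of k]
    by (simp add: prob_space)
  also have "\<dots> \<le> complete_prob k" unfolding expectation_complete
  proof (intro integral_mono integrable_complete)
    show "integrable M (\<lambda>\<omega>. 1 - real (card (missing k \<omega>) choose 1))"
      using integrable_choose[of k 1] by simp
    show "1 - real (card (missing k \<omega>) choose 1) \<le> of_bool (card (missing k \<omega>) = 0)" for \<omega>
      by (cases "card (missing k \<omega>)") (simp_all del: card_eq_0_iff)
  qed
  finally show ?thesis .
qed

text \<open>Chebyshev's inequality: the number of missing coupons has variance at most its mean.\<close>

lemma complete_prob_le: "complete_prob k \<le> 1 / mean_missing n s k"
proof -
  define m where "m = mean_missing n s k"
  have m: "0 < m" using mean_missing_pos[OF s_less] by (simp add: m_def)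
  let ?W = "\<lambda>\<omega> j. real (card (missing k \<omega>) choose j)"
  have choose_square: "(real w)\<^sup>2 = real (w choose 1) + 2 * real (w choose 2)" for w
  proof -
    have "w * w = w + 2 * (w choose 2)" by (induction w) (auto simp: numeral_2_eq_2)
    hence "real (w * w) = real (w + 2 * (w choose 2))" by presburger
    thus ?thesis by (simp add: power2_eq_square)
  qed
  \<comment> \<open>The integrand is \<open>(1 - W / m)^2\<close>, rewritten in binomial
    coefficients by \<open>choose_square\<close>. It is nonnegative and equals 1 where
    \<open>W = 0\<close>.\<close>
  have "complete_prob k \<le> expectation (\<lambda>\<omega>. 1 - 2 / m * ?W \<omega> 1 + (?W \<omega> 1 + 2 * ?W \<omega> 2) / m\<^sup>2)"
    unfolding expectation_complete
  proof (intro integral_mono integrable_complete)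
    show "integrable M (\<lambda>\<omega>. 1 - 2 / m * ?W \<omega> 1 + (?W \<omega> 1 + 2 * ?W \<omega> 2) / m\<^sup>2)"
      by (intro Bochner_Integration.integrable_add Bochner_Integration.integrable_diff
          integrable_divide integrable_mult_right integrable_choose integrable_const)
    fix \<omega>
    let ?w = "real (card (missing k \<omega>))"
    have "1 - 2 / m * ?W \<omega> 1 + (?W \<omega> 1 + 2 * ?W \<omega> 2) / m\<^sup>2 = (1 - ?w / m)\<^sup>2"
      unfolding choose_square[symmetric] using m by (simp add: power2_eq_square field_simps)
    thus "of_bool (card (missing k \<omega>) = 0) \<le> 1 - 2 / m * ?W \<omega> 1 + (?W \<omega> 1 + 2 * ?W \<omega> 2) / m\<^sup>2"
      by (cases "card (missing k \<omega>) = 0") (simp_all del: One_nat_def)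
  qed
  also have "\<dots> = 1 - 2 / m * choose_moment n s k 1 + (choose_moment n s k 1 + 2 * choose_moment n s k 2) / m\<^sup>2"
    using integrable_choose[of k 1] integrable_choose[of k 2]
      expectation_choose[of k 1] expectation_choose[of k 2]
    by (simp add: prob_space)
  also have "\<dots> = (m - m\<^sup>2 + 2 * choose_moment n s k 2) / m\<^sup>2"
    using m choose_moment_1[OF s_less, of k] by (simp add: m_def power2_eq_square field_simps)
  \<comment> \<open>The Poisson bound \<open>2 * choose_moment n s k 2 \<le> m^2\<close> is what
    keeps the variance below the mean.\<close>
  also have "\<dots> \<le> m / m\<^sup>2"
    using choose_moment_le[OF s_less, of k 2] by (intro divide_right_mono) (auto simp: m_def)
  also have "\<dots> = 1 / m" using m by (simp add: power2_eq_square)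
  finally show ?thesis by (simp add: m_def)
qed

section \<open>The collection time and its expectation\<close>

lemma missing_antimono: "k \<le> l \<Longrightarrow> missing l \<omega> \<subseteq> missing k \<omega>"
  by (fastforce simp: missing_def)

lemma less_collection_time_iff: "enat k < collection_time n X \<omega> \<longleftrightarrow> missing k \<omega> \<noteq> {}"
proof -
  define K where "K = {l. missing l \<omega> = {}}"
  have T: "collection_time n X \<omega> = (INF l\<in>K. enat l)"
    by (simp add: collection_time_def K_def missing_def)
  show ?thesis
  proof
    assume "enat k < collection_time n X \<omega>"
    thus "missing k \<omega> \<noteq> {}" unfolding T
      by (metis (mono_tags) INF_lower K_def leD mem_Collect_eq)
  next
    assume ne: "missing k \<omega> \<noteq> {}"
    \<comment> \<open>Bounding every element of \<open>K\<close> by \<open>Suc k\<close> gives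
      strict inequality also for empty \<open>K\<close>, where the infimum is \<infinity>.\<close>
    have "enat (Suc k) \<le> (INF l\<in>K. enat l)"
    proof (rule INF_greatest)
      fix l assume "l \<in> K"
      hence "\<not> l \<le> k" using ne missing_antimono[of l k \<omega>] by (auto simp: K_def)
      thus "enat (Suc k) \<le> enat l" by simp
    qed
    thus "enat k < collection_time n X \<omega>" unfolding T
      by (metis enat_ord_simps(2) lessI less_le_trans)
  qed
qed

text \<open>As \<open>enat\<close> is countable, preimages of singletons suffice, and these are
  countable Boolean combinations of the events that the time exceeds \<open>k\<close>.\<close>

lemma collection_time_measurable: "collection_time n X \<in> measurable M (count_space UNIV)"
proof -
  define G where "G k = {\<omega> \<in> space M. enat k < collection_time n X \<omega>}" for k
  have [measurable]: "G k \<in> events" for k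
  proof -
    have "G k = space M - {\<omega> \<in> space M. missing k \<omega> = {}}"
      by (auto simp: G_def less_collection_time_iff)
    thus ?thesis by auto
  qed
  have "collection_time n X -` {a} \<inter> space M \<in> events" for a
  proof (cases a)
    case (enat m)
    have "collection_time n X -` {a} \<inter> space M =
      (space M - G m) \<inter> (space M - (\<Union>i\<in>{..<m}. space M - G i))"
      (is "?L = ?R")
    proof (intro set_eqI)
      fix \<omega>
      have "collection_time n X \<omega> = enat m \<longleftrightarrow>
        \<not> enat m < collection_time n X \<omega> \<and> (\<forall>i<m. enat i < collection_time n X \<omega>)"
        by (cases "collection_time n X \<omega>") (auto simp: not_less intro: antisym leI)
      thus "\<omega> \<in> ?L \<longleftrightarrow> \<omega> \<in> ?R" using enat by (auto simp: G_def)
    qed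
    also have "?R \<in> events" by measurable
    finally show ?thesis .
  next
    case infinity
    have "collection_time n X -` {a} \<inter> space M =
      space M - (\<Union>i. space M - G i)"
      (is "?L = ?R")
    proof (intro set_eqI)
      fix \<omega>
      have "collection_time n X \<omega> = \<infinity> \<longleftrightarrow> (\<forall>i. enat i < collection_time n X \<omega>)"
        by (cases "collection_time n X \<omega>") auto
      thus "\<omega> \<in> ?L \<longleftrightarrow> \<omega> \<in> ?R" using infinity by (auto simp: G_def)
    qed
    also have "?R \<in> events" by measurable
    finally show ?thesis .
  qed
  thus ?thesis by (subst measurable_count_space_eq2_countable) auto
qed

text \<open>The tail-sum formula for a variable with values in \<open>enat\<close>; summability
  carries the series from \<open>ennreal\<close> over to the reals.\<close>

lemma expected_collection_time_eq:
  assumes "summable (\<lambda>k. 1 - complete_prob k)"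
  shows "expected_collection_time n M X = ennreal (\<Sum>k. 1 - complete_prob k)"
proof -
  have "expected_collection_time n M X
    = (\<Sum>k. emeasure M {\<omega> \<in> space M. enat k < collection_time n X \<omega>})"
    unfolding expected_collection_time_def
    by (rule nn_integral_enat_function[OF collection_time_measurable])
  also have "\<dots> = (\<Sum>k. ennreal (1 - complete_prob k))"
  proof (rule suminf_cong)
    fix k
    have "{\<omega> \<in> space M. enat k < collection_time n X \<omega>} = space M - {\<omega> \<in> space M. missing k \<omega> = {}}"
      by (auto simp: less_collection_time_iff)
    thus "emeasure M {\<omega> \<in> space M. enat k < collection_time n X \<omega>} = ennreal (1 - complete_prob k)"
      by (simp add: emeasure_eq_measure complete_prob_def prob_compl)
  qed
  also have "\<dots> = ennreal (\<Sum>k. 1 - complete_prob k)"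
    by (rule suminf_ennreal2) (auto simp: assms complete_prob_le_1)
  finally show ?thesis .
qed

text \<open>Markov's inequality supplies a geometric majorant, whose ratio
  \<open>(n - s) / n\<close> is below 1 because \<open>1 \<le> s\<close>.\<close>

lemma summable_incomplete: "summable (\<lambda>k. 1 - complete_prob k)"
proof (rule summable_comparison_test')
  show "summable (\<lambda>k. mean_missing n s k)" unfolding mean_missing_def
    using s_less s_pos by (intro summable_mult summable_geometric) (auto simp: divide_simps)
  show "norm (1 - complete_prob k) \<le> mean_missing n s k" for k
    using complete_prob_ge[of k] complete_prob_le_1[of k] by simp
qed

end

section \<open>Asymptotics\<close>

text \<open>For \<open>0 \<le> a \<le> b\<close>, factor out \<open>exp (- a) \<le> 1\<close> and
  use \<open>1 - exp (- h) \<le> h\<close> with \<open>h = b - a\<close>.\<close>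

lemma abs_exp_uminus_diff_le:
  fixes x y :: real
  assumes "0 \<le> x" "0 \<le> y"
  shows "\<bar>exp (- x) - exp (- y)\<bar> \<le> \<bar>x - y\<bar>"
proof -
  have *: "exp (- a) - exp (- b) \<le> b - a" if "0 \<le> a" "a \<le> b" for a b :: real
  proof -
    have "exp (- a) - exp (- b) = exp (- a) * (1 - exp (- (b - a)))"
      by (simp add: algebra_simps flip: exp_add)
    also have "\<dots> \<le> 1 * (b - a)"
      using that exp_ge_add_one_self[of "a - b"] by (intro mult_mono) (auto simp: algebra_simps)
    finally show ?thesis by simp
  qed
  show ?thesis using *[of x y] *[of y x] assms by (cases "x \<le> y") auto
qed

lemma exp_uminus_le_inverse: "0 < x \<Longrightarrow> exp (- x) \<le> 1 / (x :: real)"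
  using exp_ge_add_one_self[of x] unfolding exp_minus inverse_eq_divide
  by (intro divide_left_mono) (linarith, auto)

text \<open>\<open>P n k\<close> stands for the probability that all \<open>n\<close> coupons have appeared in the first \<open>k\<close> draws.\<close>

locale occupancy_asymptotics =
  fixes c :: real and s :: "nat \<Rightarrow> nat" and P :: "nat \<Rightarrow> nat \<Rightarrow> real"
  assumes c: "0 < c" "c < 1"
    and s_close: "\<forall>\<^sub>F n in sequentially. \<bar>real (s n) - c * real n\<bar> < 1"
    and s_less: "\<forall>\<^sub>F n in sequentially. s n < n"
    and P_nonneg: "\<forall>\<^sub>F n in sequentially. \<forall>k. 0 \<le> P n k"
    and P_le_1: "\<forall>\<^sub>F n in sequentially. \<forall>k. P n k \<le> 1"
    and P_ge: "\<forall>\<^sub>F n in sequentially. \<forall>k. 1 - mean_missing n (s n) k \<le> P n k"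
    and P_le: "\<forall>\<^sub>F n in sequentially. \<forall>k. P n k \<le> 1 / mean_missing n (s n) k"
    and P_approx: "\<forall>\<^sub>F n in sequentially. \<forall>k. \<bar>P n k - exp (- mean_missing n (s n) k)\<bar>
      \<le> real (k + 1) / real (n - s n) * exp (4 * mean_missing n (s n) k)"
begin

section \<open>Reference time and oscillating scale\<close>

definition q :: real where "q = 1 - c"
text \<open>The exact probability that a given coupon is absent from one package; \<open>q\<close>
  is its limit.\<close>

definition \<rho> :: "nat \<Rightarrow> real" where "\<rho> n = real (n - s n) / real n"
definition L :: "nat \<Rightarrow> real" where "L n = log (1 / q) (real n)"
definition f :: "nat \<Rightarrow> nat" where "f n = nat \<lfloor>L n\<rfloor>"
text \<open>By \<open>n_eq\<close> this is \<open>n * q ^ f n\<close> for \<open>n \<ge> 1\<close>.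
  It stays between 1 and \<open>1 / q\<close> but follows the fractional part of \<open>L n\<close>,
  so the limits below are stated for differences from expressions in \<open>u n\<close>.\<close>

definition u :: "nat \<Rightarrow> real" where "u n = (1 / q) powr frac (L n)"
text \<open>The mean number of missing coupons at the reference time \<open>f n\<close>.\<close>

definition \<mu> :: "nat \<Rightarrow> real" where "\<mu> n = real n * \<rho> n ^ f n"

lemma q: "0 < q" "q < 1"
  using c by (auto simp: q_def)

lemma u_bounds: "1 \<le> u n" "u n \<le> 1 / q"
proof -
  have "(1 / q) powr 0 \<le> u n" unfolding u_def
    using q by (intro powr_mono) auto
  thus "1 \<le> u n" using q by simp
  have "u n \<le> (1 / q) powr 1" unfolding u_def
    using q frac_lt_1[of "L n"] by (intro powr_mono) (auto intro: less_imp_le)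
  thus "u n \<le> 1 / q" using q by simp
qed

lemma L_nonneg: "1 \<le> n \<Longrightarrow> 0 \<le> L n"
  unfolding L_def using q by (subst zero_le_log_cancel_iff) auto

lemma floor_L: "1 \<le> n \<Longrightarrow> real_of_int \<lfloor>L n\<rfloor> = real (f n)"
  using L_nonneg[of n] by (simp add: f_def)

lemma n_eq: "1 \<le> n \<Longrightarrow> real n = (1 / q) ^ f n * u n"
proof -
  assume n: "1 \<le> n"
  have "real n = (1 / q) powr L n"
    unfolding L_def using n q by (subst powr_log_cancel) auto
  also have "L n = real (f n) + frac (L n)"
    using floor_L[OF n] by (simp add: frac_def)
  finally show ?thesis using q by (simp add: powr_add powr_realpow u_def)
qed

lemma f_le_L: "1 \<le> n \<Longrightarrow> real (f n) \<le> L n"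
  using floor_L[of n] by linarith

section \<open>Growth of the reference time and effect of rounding\<close>

lemma f_div_n: "(\<lambda>n. real (f n) / real n) \<longlonglongrightarrow> 0"
proof (rule tendsto_sandwich[OF _ _ tendsto_const])
  show "(\<lambda>n. L n / real n) \<longlonglongrightarrow> 0"
    unfolding L_def log_def using tendsto_mult_right_zero[OF lim_ln_over_n, of "1 / ln (1 / q)"]
    by (simp add: field_simps)
  show "\<forall>\<^sub>F n in sequentially. real (f n) / real n \<le> L n / real n"
    using eventually_ge_at_top[of 1] by eventually_elim (auto intro!: divide_right_mono f_le_L)
qed auto

lemma f_at_top: "filterlim f at_top sequentially"
proof -
  have "filterlim (\<lambda>n. 1 / ln (1 / q) * ln (real n)) at_top sequentially"
    by (rule filterlim_tendsto_pos_mult_at_top[OF tendsto_const])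
      (use q in \<open>auto intro: filterlim_compose[OF ln_at_top filterlim_real_sequentially]\<close>)
  hence "filterlim L at_top sequentially"
    by (simp add: L_def [abs_def] log_def)
  hence "filterlim (\<lambda>n. \<lfloor>L n\<rfloor>) at_top sequentially"
    by (rule filterlim_compose[OF filterlim_floor_sequentially])
  thus ?thesis unfolding f_def by (rule filterlim_compose[OF filterlim_nat_sequentially])
qed

lemma \<rho>_close: "\<forall>\<^sub>F n in sequentially. \<bar>\<rho> n - q\<bar> \<le> 1 / real n"
  using s_close s_less
proof eventually_elim
  case (elim n)
  have "\<rho> n - q = - (real (s n) - c * real n) / real n"
    using elim by (simp add: \<rho>_def q_def field_simps)
  thus ?case using elim by (simp add: divide_right_mono)
qed

lemma \<rho>_tendsto: "\<rho> \<longlonglongrightarrow> q"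
proof -
  have "(\<lambda>n. \<rho> n - q) \<longlonglongrightarrow> 0"
    by (rule Lim_null_comparison[OF _ lim_1_over_n]) (use \<rho>_close in simp)
  thus ?thesis by (simp add: LIM_zero_iff)
qed

text \<open>One ratio differs from 1 by at most \<open>1 / (n q)\<close>, and there are only
  \<open>f n = o(n)\<close> factors. Bernoulli's inequality gives the lower bound,
  \<open>1 + x \<le> exp x\<close> the upper one.\<close>

lemma \<rho>_power_tendsto: "(\<lambda>n. (\<rho> n / q) ^ f n) \<longlonglongrightarrow> 1"
proof (rule tendsto_sandwich)
  have *: "(\<lambda>n. real (f n) / real n / q) \<longlonglongrightarrow> 0"
    using tendsto_divide[OF f_div_n tendsto_const[of q]] q by simp
  show "(\<lambda>n. 1 - real (f n) / real n / q) \<longlonglongrightarrow> 1"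
    using tendsto_diff[OF tendsto_const * , of 1] by simp
  show "(\<lambda>n. exp (real (f n) / real n / q)) \<longlonglongrightarrow> 1"
    using tendsto_exp[OF *] by simp
  have **: "\<forall>\<^sub>F n in sequentially. \<bar>\<rho> n / q - 1\<bar> \<le> 1 / (real n * q) \<and> 0 \<le> \<rho> n / q"
    using \<rho>_close
  proof eventually_elim
    case (elim n)
    have "\<rho> n / q - 1 = (\<rho> n - q) / q" using q by (simp add: field_simps)
    hence "\<bar>\<rho> n / q - 1\<bar> = \<bar>\<rho> n - q\<bar> / q" using q by simp
    also have "\<dots> \<le> 1 / real n / q" using elim q by (intro divide_right_mono) auto
    finally show ?case using q by (simp add: \<rho>_def)
  qed
  show "\<forall>\<^sub>F n in sequentially. 1 - real (f n) / real n / q \<le> (\<rho> n / q) ^ f n"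
    using **
  proof eventually_elim
    case (elim n)
    have "1 + real (f n) * (\<rho> n / q - 1) \<le> (1 + (\<rho> n / q - 1)) ^ f n"
      using elim by (intro Bernoulli_inequality) auto
    moreover have "real (f n) * - (1 / (real n * q)) \<le> real (f n) * (\<rho> n / q - 1)"
      using elim by (intro mult_left_mono) auto
    ultimately show ?case by simp
  qed
  show "\<forall>\<^sub>F n in sequentially. (\<rho> n / q) ^ f n \<le> exp (real (f n) / real n / q)"
    using **
  proof eventually_elim
    case (elim n)
    have "(\<rho> n / q) ^ f n \<le> exp (1 / (real n * q)) ^ f n"
      using elim exp_ge_add_one_self[of "1 / (real n * q)"] by (intro power_mono) linarith+
    thus ?case by (simp only: exp_of_nat_mult [symmetric] times_divide_eq_right mult_1_right divide_divide_eq_left)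
  qed
qed

lemma \<mu>_eq: "1 \<le> n \<Longrightarrow> \<mu> n = u n * (\<rho> n / q) ^ f n"
  unfolding \<mu>_def by (subst n_eq) (auto simp: power_divide)

lemma u_bounded_mult:
  assumes "X \<longlonglongrightarrow> 0"
  shows "(\<lambda>n. u n * X n) \<longlonglongrightarrow> 0"
proof (rule Lim_null_comparison)
  show "(\<lambda>n. 1 / q * \<bar>X n\<bar>) \<longlonglongrightarrow> 0"
    by (intro tendsto_mult_right_zero tendsto_rabs_zero assms)
  have "norm (u n * X n) \<le> 1 / q * \<bar>X n\<bar>" for n
    unfolding real_norm_def abs_mult using u_bounds[of n] by (intro mult_right_mono) auto
  thus "\<forall>\<^sub>F n in sequentially. norm (u n * X n) \<le> 1 / q * \<bar>X n\<bar>" by simp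
qed

lemma \<mu>_tendsto: "(\<lambda>n. \<mu> n - u n) \<longlonglongrightarrow> 0"
proof -
  have "(\<lambda>n. u n * ((\<rho> n / q) ^ f n - 1)) \<longlonglongrightarrow> 0"
    by (rule u_bounded_mult) (rule LIM_zero[OF \<rho>_power_tendsto])
  moreover have "\<forall>\<^sub>F n in sequentially. u n * ((\<rho> n / q) ^ f n - 1) = \<mu> n - u n"
    using eventually_ge_at_top[of 1] by eventually_elim (simp add: \<mu>_eq algebra_simps)
  ultimately show ?thesis by (rule Lim_transform_eventually)
qed

text \<open>Serves both directions from \<open>f n\<close>: forward with \<open>r = \<rho>\<close>,
  backward with \<open>r = 1 / \<rho>\<close>. The mean is within \<open>o(1)\<close> of
  \<open>u n * r0 ^ i\<close>, hence bounded, so the Poisson error vanishes; the Lipschitz bound for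
  \<open>exp\<close> does the rest.\<close>

lemma P_tendsto:
  assumes r: "r \<longlonglongrightarrow> r0" "0 \<le> r0"
    and mean: "\<forall>\<^sub>F n in sequentially. mean_missing n (s n) (k n) = \<mu> n * r n ^ i"
    and k: "\<forall>\<^sub>F n in sequentially. k n \<le> f n + i"
  shows "(\<lambda>n. P n (k n) - exp (- (u n * r0 ^ i))) \<longlonglongrightarrow> 0"
proof -
  let ?m = "\<lambda>n. mean_missing n (s n) (k n)"
  have "(\<lambda>n. (\<mu> n - u n) * r n ^ i + u n * (r n ^ i - r0 ^ i)) \<longlonglongrightarrow> 0 * r0 ^ i + 0"
    by (intro tendsto_add tendsto_mult tendsto_power u_bounded_mult \<mu>_tendsto r)
      (rule LIM_zero[OF tendsto_power[OF r(1)]])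
  hence 1: "(\<lambda>n. \<mu> n * r n ^ i - u n * r0 ^ i) \<longlonglongrightarrow> 0"
    by (simp add: algebra_simps)
  have 2: "(\<lambda>n. ?m n - u n * r0 ^ i) \<longlonglongrightarrow> 0"
    by (rule Lim_transform_eventually[OF 1]) (use mean in \<open>eventually_elim, simp\<close>)
  have m_bd: "\<forall>\<^sub>F n in sequentially. ?m n \<le> 1 + r0 ^ i / q"
    using order_tendstoD(2)[OF 2 zero_less_one]
  proof eventually_elim
    case (elim n)
    have "u n * r0 ^ i \<le> 1 / q * r0 ^ i" using u_bounds r(2) by (intro mult_right_mono) auto
    thus ?case using elim by simp
  qed
  \<comment> \<open>The error bound of \<open>P_approx\<close> with \<open>k n \<le> f n + i\<close>
    and the mean bounded by \<open>m_bd\<close>, after dividing numerator and denominator by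
    \<open>n\<close>.\<close>
  have "(\<lambda>n. (real (f n) / real n + real (i + 1) * (1 / real n)) / \<rho> n * exp (4 * (1 + r0 ^ i / q)))
    \<longlonglongrightarrow> (0 + real (i + 1) * 0) / q * exp (4 * (1 + r0 ^ i / q))"
    using q by (intro tendsto_intros f_div_n \<rho>_tendsto lim_1_over_n) auto
  hence 3: "(\<lambda>n. (real (f n) / real n + real (i + 1) * (1 / real n)) / \<rho> n * exp (4 * (1 + r0 ^ i / q))) \<longlonglongrightarrow> 0"
    by simp
  have 4: "(\<lambda>n. P n (k n) - exp (- ?m n)) \<longlonglongrightarrow> 0"
  proof (rule Lim_null_comparison[OF _ 3])
    show "\<forall>\<^sub>F n in sequentially. norm (P n (k n) - exp (- ?m n))
      \<le> (real (f n) / real n + real (i + 1) * (1 / real n)) / \<rho> n * exp (4 * (1 + r0 ^ i / q))"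
      using P_approx m_bd k s_less
    proof eventually_elim
      case (elim n)
      have "norm (P n (k n) - exp (- ?m n)) \<le> real (k n + 1) / real (n - s n) * exp (4 * ?m n)"
        using elim by simp
      also have "\<dots> \<le> real (f n + i + 1) / real (n - s n) * exp (4 * (1 + r0 ^ i / q))"
        using elim by (intro mult_mono divide_right_mono) auto
      also have "real (f n + i + 1) / real (n - s n)
        = (real (f n) / real n + real (i + 1) * (1 / real n)) / \<rho> n"
        using elim by (simp add: \<rho>_def field_simps)
      finally show ?case .
    qed
  qed
  have 5: "(\<lambda>n. exp (- ?m n) - exp (- (u n * r0 ^ i))) \<longlonglongrightarrow> 0"
  proof (rule Lim_null_comparison[OF _ tendsto_rabs_zero[OF 2]])
    show "\<forall>\<^sub>F n in sequentially. norm (exp (- ?m n) - exp (- (u n * r0 ^ i))) \<le> \<bar>?m n - u n * r0 ^ i\<bar>"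
      using u_bounds r(2)
      by (auto intro!: always_eventually abs_exp_uminus_diff_le mult_nonneg_nonneg
          simp: mean_missing_def order.trans[OF zero_le_one])
  qed
  show ?thesis using tendsto_add[OF 4 5] by simp
qed

section \<open>Termwise limits\<close>

lemma mean_above: "mean_missing n (s n) (f n + i) = \<mu> n * \<rho> n ^ i"
  by (simp add: mean_missing_def \<mu>_def \<rho>_def power_add)

text \<open>Each draw taken back divides the mean by \<open>\<rho> n\<close>; \<open>i < f n\<close>
  keeps the subtraction from truncating.\<close>

lemma mean_below:
  assumes "s n < n" "i < f n"
  shows "mean_missing n (s n) (f n - Suc i) = \<mu> n * (1 / \<rho> n) ^ Suc i"
proof -
  have "\<rho> n \<noteq> 0" using assms by (simp add: \<rho>_def)
  hence "\<rho> n ^ (f n - Suc i) = \<rho> n ^ f n * (1 / \<rho> n) ^ Suc i"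
    using assms by (simp add: power_diff power_divide del: power_Suc)
  thus ?thesis by (simp add: mean_missing_def \<mu>_def \<rho>_def)
qed

text \<open>Term \<open>i\<close>, counted from 0, pairs the times \<open>f n + i\<close> and
  \<open>f n - Suc i\<close> and subtracts the corresponding term of \<open>g\<close>. The
  conditional extends the finite backward sum to a series.\<close>

definition err :: "nat \<Rightarrow> nat \<Rightarrow> real" where
  "err i n = (1 - P n (f n + i)) - (if i < f n then P n (f n - Suc i) else 0)
    - (1 - exp (- (u n * q ^ i)) - exp (- (u n * (1 / q) ^ Suc i)))"

lemma err_tendsto: "err i \<longlonglongrightarrow> 0"
proof -
  have up: "(\<lambda>n. P n (f n + i) - exp (- (u n * q ^ i))) \<longlonglongrightarrow> 0"
    by (rule P_tendsto[OF \<rho>_tendsto]) (use q in \<open>auto simp: mean_above\<close>)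
  \<comment> \<open>For fixed \<open>i\<close> the conditional in \<open>err\<close> eventually
    takes its first branch.\<close>
  have large: "\<forall>\<^sub>F n in sequentially. i < f n"
    using f_at_top eventually_compose_filterlim[OF eventually_gt_at_top] by blast
  have low: "(\<lambda>n. P n (f n - Suc i) - exp (- (u n * (1 / q) ^ Suc i))) \<longlonglongrightarrow> 0"
  proof (rule P_tendsto)
    show "(\<lambda>n. 1 / \<rho> n) \<longlonglongrightarrow> 1 / q"
      using q by (intro tendsto_intros \<rho>_tendsto) auto
    show "\<forall>\<^sub>F n in sequentially. f n - Suc i \<le> f n + Suc i"
      by (intro always_eventually allI) simp
    show "\<forall>\<^sub>F n in sequentially. mean_missing n (s n) (f n - Suc i) = \<mu> n * (1 / \<rho> n) ^ Suc i"
      using large s_less by eventually_elim (rule mean_below)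
  qed (use q in auto)
  have "(\<lambda>n. - (P n (f n + i) - exp (- (u n * q ^ i)))
      - (P n (f n - Suc i) - exp (- (u n * (1 / q) ^ Suc i)))) \<longlonglongrightarrow> 0"
    using tendsto_diff[OF tendsto_minus[OF up] low] by simp
  thus ?thesis
    by (rule Lim_transform_eventually) (use large in \<open>eventually_elim, simp add: err_def\<close>)
qed

text \<open>Geometric decay uniform in \<open>n\<close>, from \<open>1 - exp (- x) \<le> x\<close>
  with \<open>u n \<le> 1 / q\<close> and from \<open>exp (- x) \<le> 1 / x\<close> with
  \<open>1 \<le> u n\<close>.\<close>

lemma g_term_bounds:
  "0 \<le> 1 - exp (- (u n * q ^ i))" "1 - exp (- (u n * q ^ i)) \<le> 1 / q * q ^ i"
  "exp (- (u n * (1 / q) ^ Suc i)) \<le> q ^ i"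
proof -
  show "0 \<le> 1 - exp (- (u n * q ^ i))" using u_bounds[of n] q by simp
  have "1 - exp (- (u n * q ^ i)) \<le> u n * q ^ i"
    using exp_ge_add_one_self[of "- (u n * q ^ i)"] by simp
  also have "\<dots> \<le> 1 / q * q ^ i" using u_bounds q by (intro mult_right_mono) auto
  finally show "1 - exp (- (u n * q ^ i)) \<le> 1 / q * q ^ i" .
  have "exp (- (u n * (1 / q) ^ Suc i)) \<le> exp (- (1 * (1 / q) ^ i))"
    using mult_mono[of 1 "u n" "(1 / q) ^ i" "(1 / q) ^ Suc i"] u_bounds[of n] q power_increasing[of i "Suc i" "1 / q"]
    by (simp del: power_Suc)
  also have "\<dots> \<le> q ^ i"
    using exp_uminus_le_inverse[of "(1 / q) ^ i"] q by (simp add: power_divide)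
  finally show "exp (- (u n * (1 / q) ^ Suc i)) \<le> q ^ i" .
qed

lemma summable_g_terms:
  "summable (\<lambda>i. 1 - exp (- (u n * q ^ i)) - exp (- (u n * (1 / q) ^ Suc i)))"
proof (rule summable_comparison_test')
  show "summable (\<lambda>i. 1 / q * q ^ i + q ^ i)"
    using q by (intro summable_add summable_mult summable_geometric) auto
  show "norm (1 - exp (- (u n * q ^ i)) - exp (- (u n * (1 / q) ^ Suc i))) \<le> 1 / q * q ^ i + q ^ i" for i
    using g_term_bounds[of n i] exp_ge_zero[of "- (u n * (1 / q) ^ Suc i)"]
    unfolding real_norm_def abs_le_iff by linarith
qed

text \<open>Here \<open>u n = q powr (- frac (L n))\<close>; since the series is indexed by
  \<open>Suc i\<close>, the first exponent becomes \<open>i - frac (L n)\<close>.\<close>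

lemma g_eq: "g c (frac (L n)) = (\<Sum>i. 1 - exp (- (u n * q ^ i)) - exp (- (u n * (1 / q) ^ Suc i)))"
proof -
  have 1: "(1 - c) powr (real (Suc i) - frac (L n) - 1) = u n * q ^ i" for i
  proof -
    have "(1 - c) powr (real (Suc i) - frac (L n) - 1) = q powr (real i - frac (L n))"
      by (simp add: q_def algebra_simps)
    also have "\<dots> = u n * q ^ i"
      using q by (simp add: u_def powr_diff powr_realpow powr_divide)
    finally show ?thesis .
  qed
  have 2: "(1 - c) powr (- real (Suc i) - frac (L n)) = u n * (1 / q) ^ Suc i" for i
  proof -
    have "(1 - c) powr (- real (Suc i) - frac (L n)) = q powr (- real (Suc i)) / q powr frac (L n)"
      using q by (simp add: powr_diff flip: q_def del: of_nat_Suc)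
    also have "q powr (- real (Suc i)) = (1 / q) ^ Suc i"
      using q by (simp add: powr_minus powr_realpow power_divide divide_inverse power_inverse del: of_nat_Suc power_Suc)
    finally show ?thesis using q by (simp add: u_def powr_divide)
  qed
  show ?thesis unfolding g_def 1 2 ..
qed

text \<open>Split the tail sum at \<open>f n\<close>. Its initial part is \<open>f n\<close> minus
  the sum of \<open>P n k\<close> over \<open>k < f n\<close>, which is read backwards through
  \<open>k = f n - Suc i\<close>.\<close>

lemma expectation_eq_sum_err:
  assumes "1 \<le> n" and summable: "summable (\<lambda>k. 1 - P n k)"
  shows "(\<Sum>i. err i n) = (\<Sum>k. 1 - P n k) - (real_of_int \<lfloor>L n\<rfloor> + g c (frac (L n)))"
proof -
  have s1: "(\<lambda>i. 1 - P n (f n + i)) sums ((\<Sum>k. 1 - P n k) - (\<Sum>k<f n. 1 - P n k))"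
    using sums_split_initial_segment[OF summable_sums[OF summable], of "f n"] by (simp add: add.commute)
  have s2: "(\<lambda>i. if i < f n then P n (f n - Suc i) else 0) sums (\<Sum>i<f n. P n (f n - Suc i))"
    using sums_If_finite[of "\<lambda>i. i < f n" "\<lambda>i. P n (f n - Suc i)"] by (simp add: lessThan_def)
  have "(\<Sum>i<f n. P n (f n - Suc i)) = (\<Sum>k<f n. P n k)"
    by (rule sum.nat_diff_reindex)
  moreover have "(\<Sum>k<f n. 1 - P n k) = real (f n) - (\<Sum>k<f n. P n k)"
    by (simp add: sum_subtractf)
  moreover have "(\<lambda>i. err i n) sums (((\<Sum>k. 1 - P n k) - (\<Sum>k<f n. 1 - P n k))
      - (\<Sum>i<f n. P n (f n - Suc i)) - g c (frac (L n)))"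
    unfolding err_def g_eq by (intro sums_diff s1 s2 summable_sums summable_g_terms)
  ultimately show ?thesis
    using sums_unique floor_L[OF assms(1)] by fastforce
qed

section \<open>Uniform domination and exchange of limit and sum\<close>

lemma \<mu>_bounds: "\<forall>\<^sub>F n in sequentially. 1 / 2 \<le> \<mu> n \<and> \<mu> n \<le> 2 / q"
proof -
  have "\<forall>\<^sub>F n in sequentially. 1 / 2 < (\<rho> n / q) ^ f n" "\<forall>\<^sub>F n in sequentially. (\<rho> n / q) ^ f n < 2"
    using order_tendstoD(1)[OF \<rho>_power_tendsto, of "1 / 2"] order_tendstoD(2)[OF \<rho>_power_tendsto, of 2]
    by simp_all
  thus ?thesis using eventually_ge_at_top[of 1]
  proof eventually_elim
    case (elim n)
    have "1 * (1 / 2) \<le> u n * (\<rho> n / q) ^ f n" "u n * (\<rho> n / q) ^ f n \<le> 1 / q * 2"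
      using elim u_bounds[of n] q by (intro mult_mono; linarith | simp)+
    thus ?case unfolding \<mu>_eq[OF elim(3)] by simp
  qed
qed

text \<open>The ratio \<open>(1 + q) / 2\<close> lies strictly between \<open>q\<close> and 1, so
  eventually \<open>\<rho> n\<close> is below it and one geometric majorant serves all large
  \<open>n\<close>.\<close>

lemma err_bound: "\<forall>\<^sub>F n in sequentially. \<forall>i. norm (err i n) \<le> (3 / q + 3) * ((1 + q) / 2) ^ i"
proof -
  have "\<forall>\<^sub>F n in sequentially. \<rho> n < (1 + q) / 2"
    by (rule order_tendstoD(2)[OF \<rho>_tendsto]) (use q in auto)
  thus ?thesis using \<mu>_bounds P_nonneg P_le_1 P_ge P_le s_less
  proof eventually_elim
    case (elim n)
    define t where "t = (1 + q) / 2"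
    have t: "0 < t" "t < 1" "q \<le> t" using q by (auto simp: t_def)
    have \<rho>: "0 < \<rho> n" "\<rho> n \<le> t" using elim by (auto simp: \<rho>_def t_def)
    show ?case
    proof
      fix i
      have pow: "\<rho> n ^ i \<le> t ^ i" "q ^ i \<le> t ^ i"
        using \<rho> q t by (auto intro!: power_mono)
      have "1 - P n (f n + i) \<le> \<mu> n * \<rho> n ^ i"
        using elim mean_above[of n i] by (metis diff_le_eq add.commute)
      also have "\<dots> \<le> 2 / q * t ^ i"
        using elim pow \<rho> q by (intro mult_mono) auto
      finally have 1: "1 - P n (f n + i) \<le> 2 / q * t ^ i" .
      have 2: "(if i < f n then P n (f n - Suc i) else 0) \<le> 2 * t ^ i"
      proof (cases "i < f n")
        case True
        \<comment> \<open>The Chebyshev bound: going back in time the mean grows geometrically, so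
          its inverse decays.\<close>
        have "P n (f n - Suc i) \<le> 1 / (\<mu> n * (1 / \<rho> n) ^ Suc i)"
          using elim mean_below[of n i] True by metis
        also have "\<dots> = 1 / \<mu> n * \<rho> n ^ Suc i"
          by (simp add: power_divide del: power_Suc)
        also have "\<dots> \<le> 2 * t ^ Suc i"
          using elim \<rho> by (intro mult_mono power_mono) (auto simp: field_simps)
        also have "\<dots> \<le> 2 * t ^ i" using t by (simp add: mult_le_cancel_right1)
        finally show ?thesis using True by simp
      qed (use t in simp)
      have 3: "1 / q * q ^ i \<le> 1 / q * t ^ i"
        using pow q by (intro mult_left_mono) auto
      have 4: "0 \<le> (if i < f n then P n (f n - Suc i) else 0)" using elim by simp
      \<comment> \<open>The summands with \<open>2 / q\<close> and \<open>2\<close> bound the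
        forward and backward probabilities, those with \<open>1 / q\<close> and \<open>1\<close> the
        two parts of the term of \<open>g\<close>.\<close>
      have 5: "(3 / q + 3) * t ^ i = 2 / q * t ^ i + 1 / q * t ^ i + 2 * t ^ i + t ^ i"
        by (simp add: field_simps)
      have 6: "0 \<le> t ^ i" using t by simp
      have 7: "P n (f n + i) \<le> 1" using elim by simp
      show "norm (err i n) \<le> (3 / q + 3) * ((1 + q) / 2) ^ i"
        unfolding t_def[symmetric] 5 unfolding err_def real_norm_def abs_le_iff
        using 1 2 3 4 pow(2) 6 7 g_term_bounds[of n i]
          exp_ge_zero[of "- (u n * (1 / q) ^ Suc i)"] by linarith
    qed
  qed
qed

lemma occupancy_expectation:
  assumes "\<forall>\<^sub>F n in sequentially. summable (\<lambda>k. 1 - P n k)"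
  shows "(\<lambda>n. (\<Sum>k. 1 - P n k) - (real_of_int \<lfloor>L n\<rfloor> + g c (frac (L n)))) \<longlonglongrightarrow> 0"
proof -
  have "\<forall>\<^sub>F (i, n) in at_top \<times>\<^sub>F sequentially. norm (err i n) \<le> (3 / q + 3) * ((1 + q) / 2) ^ i"
  proof -
    have "\<forall>\<^sub>F (_ :: nat, n) in at_top \<times>\<^sub>F sequentially. \<forall>i. norm (err i n) \<le> (3 / q + 3) * ((1 + q) / 2) ^ i"
      using err_bound by (subst eventually_prod2) auto
    thus ?thesis by (rule eventually_mono) auto
  qed
  moreover have "summable (\<lambda>i. (3 / q + 3) * ((1 + q) / 2) ^ i)"
    using q by (intro summable_mult summable_geometric) auto
  \<comment> \<open>Tannery's theorem takes the majorant along a product filter;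
    \<open>err_bound\<close>, being uniform in \<open>i\<close>, provides it there.\<close>
  ultimately have "(\<lambda>n. \<Sum>i. err i n) \<longlonglongrightarrow> (\<Sum>i. 0)"
    by (intro tannerys_theorem[THEN conjunct2, THEN conjunct2] err_tendsto) auto
  hence "(\<lambda>n. \<Sum>i. err i n) \<longlonglongrightarrow> 0" by simp
  moreover have "\<forall>\<^sub>F n in sequentially.
      (\<Sum>i. err i n) = (\<Sum>k. 1 - P n k) - (real_of_int \<lfloor>L n\<rfloor> + g c (frac (L n)))"
    using assms eventually_ge_at_top[of 1] by eventually_elim (rule expectation_eq_sum_err)
  ultimately show ?thesis by (rule Lim_transform_eventually)
qed

end

theorem theorem2p2:
  fixes c :: real and s :: "nat \<Rightarrow> nat"
    and M :: "nat \<Rightarrow> 'w measure" and X :: "nat \<Rightarrow> nat \<Rightarrow> 'w \<Rightarrow> nat set"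
  assumes "0 < c" and "c < 1"
    and "\<forall>\<^sub>F n in sequentially. \<bar>real (s n) - c * real n\<bar> < 1"
    and "\<forall>\<^sub>F n in sequentially. group_drawings n (s n) (M n) (X n)"
  shows "(\<forall>\<^sub>F n in sequentially. expected_collection_time n (M n) (X n) < \<infinity>) \<and>
         (\<lambda>n. enn2real (expected_collection_time n (M n) (X n))
               - (real_of_int \<lfloor>log (1 / (1 - c)) (real n)\<rfloor>
                  + g c (frac (log (1 / (1 - c)) (real n))))) \<in> o(\<lambda>_. 1)"
proof -
  define P where "P n k = drawings.complete_prob n (M n) (X n) k" for n k
  \<comment> \<open>The drawings exist only for large \<open>n\<close>, so the facts of the locale
    are used under the eventuality quantifier.\<close>
  have *: "\<forall>\<^sub>F n in sequentially. drawings n (s n) (M n) (X n)"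
    using assms(4) by eventually_elim
      (simp add: drawings_def drawings_axioms_def group_drawings_def)
  interpret occupancy_asymptotics c s P
  proof
    show "0 < c" "c < 1" by fact+
    show "\<forall>\<^sub>F n in sequentially. \<bar>real (s n) - c * real n\<bar> < 1" by fact
    show "\<forall>\<^sub>F n in sequentially. s n < n"
      using * by eventually_elim (rule drawings.s_less)
    show "\<forall>\<^sub>F n in sequentially. \<forall>k. 0 \<le> P n k"
      using * by eventually_elim (simp add: P_def drawings.complete_prob_def)
    show "\<forall>\<^sub>F n in sequentially. \<forall>k. P n k \<le> 1"
      using * by eventually_elim (simp only: P_def drawings.complete_prob_le_1 simp_thms)
    show "\<forall>\<^sub>F n in sequentially. \<forall>k. 1 - mean_missing n (s n) k \<le> P n k"
      using * by eventually_elim (simp add: P_def drawings.complete_prob_ge)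
    show "\<forall>\<^sub>F n in sequentially. \<forall>k. P n k \<le> 1 / mean_missing n (s n) k"
      using * by eventually_elim (simp only: P_def drawings.complete_prob_le simp_thms)
    show "\<forall>\<^sub>F n in sequentially. \<forall>k. \<bar>P n k - exp (- mean_missing n (s n) k)\<bar>
      \<le> real (k + 1) / real (n - s n) * exp (4 * mean_missing n (s n) k)"
      using * by eventually_elim (simp only: P_def drawings.complete_prob_approx simp_thms)
  qed
  have summable: "\<forall>\<^sub>F n in sequentially. summable (\<lambda>k. 1 - P n k)"
    using * by eventually_elim (simp only: P_def drawings.summable_incomplete)
  have E: "\<forall>\<^sub>F n in sequentially. expected_collection_time n (M n) (X n) = ennreal (\<Sum>k. 1 - P n k)"
    using * by eventually_elim
      (simp only: P_def drawings.expected_collection_time_eq drawings.summable_incomplete)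
  have "(\<lambda>n. enn2real (expected_collection_time n (M n) (X n))
     - (real_of_int \<lfloor>log (1 / (1 - c)) (real n)\<rfloor> + g c (frac (log (1 / (1 - c)) (real n))))) \<longlonglongrightarrow> 0"
    using occupancy_expectation[OF summable]
  proof (rule Lim_transform_eventually)
    show "\<forall>\<^sub>F n in sequentially. (\<Sum>k. 1 - P n k) - (real_of_int \<lfloor>L n\<rfloor> + g c (frac (L n)))
      = enn2real (expected_collection_time n (M n) (X n))
        - (real_of_int \<lfloor>log (1 / (1 - c)) (real n)\<rfloor> + g c (frac (log (1 / (1 - c)) (real n))))"
      using E summable P_le_1
    proof eventually_elim
      case (elim n)
      \<comment> \<open>Nonnegativity lets \<open>enn2real\<close> undo
        \<open>ennreal\<close>.\<close>
      have "0 \<le> (\<Sum>k. 1 - P n k)"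
        by (rule suminf_nonneg[OF elim(2)]) (simp add: elim(3))
      thus ?case by (simp add: elim(1) L_def q_def)
    qed
  qed
  moreover have "\<forall>\<^sub>F n in sequentially. expected_collection_time n (M n) (X n) < \<infinity>"
    using E by eventually_elim simp
  ultimately show ?thesis by (auto simp: intro!: smalloI_tendsto)
qed

end
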